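(* Let $(\Omega,\mathcal{A},\mu,\mathcal{R},\alpha)$ be a computable measure space with $\mu(\Omega)=\infty$, with $(C_n)$, $(D_n)$, $\delta_\mu$ and $\delta_{\widetilde{\mu}}$ as in the context. Then $\delta_\mu<\delta_{\widetilde{\mu}}$, i.e. $\delta_\mu\le\delta_{\widetilde{\mu}}$ and $\delta_{\widetilde{\mu}}\not\le\delta_\mu$.
   Context: Let $\Sigma$ be a finite alphabet with $\{0,1\}\subseteq\Sigma$, $\Sigma^*$ the finite and $\Sigma^\omega$ the infinite strings over $\Sigma$. A partial string function is computable if it is computed by a Type-2 Turing machine (one-way output tape; infinite outputs written forever). A naming system of a set $X$ is a surjective partial multi-valued map $\delta:\subseteq W\rightrightarrows X$, $W\in\{\Sigma^*,\Sigma^\omega\}$ (notation if $W=\Sigma^*$, multi-representation if $W=\Sigma^\omega$); $p$ is a $\delta$-name of $x$ if $x\in\delta(p)$. For naming systems $\delta$ of $X$, $\gamma$ of $Y$, $f:\subseteq X\rightrightarrows Y$ is $(\delta,\gamma)$-computable if some computable string function $F$ satisfies $f(x)\cap\gamma(F(p))\neq\emptyset$ for every $\delta$-name $p$ of every $x\in\mathrm{dom}(f)$. For naming systems $\delta,\gamma$ of the same set, $\delta\le\gamma$ means the identity is $(\delta,\gamma)$-computable. $\nu_{\mathbb{N}}$ is the standard notation of $\mathbb{N}$, $\rho$ the standard representation of $\mathbb{R}$. A computable measure space is a quintuple $(\Omega,\mathcal{A},\mu,\mathcal{R},\alpha)$ with $(\Omega,\mathcal{A},\mu)$ a measure space, $\mathcal{R}$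 a countable ring of subsets of $\Omega$ with $\sigma(\mathcal{R})=\mathcal{A}$, $\alpha:\subseteq\Sigma^*\to\mathcal{R}$ a notation of $\mathcal{R}$ with recursive domain, $\mu$ on $\mathcal{R}$ $(\alpha,\rho)$-computable, and union and difference on $\mathcal{R}$ computable w.r.t. $\alpha$. Assume $\mu(\Omega)=\infty$ and fix sequences $(C_n)_{n\ge1},(D_n)_{n\ge1}$ in $\mathcal{R}$ with $n\mapsto C_n$ $(\nu_{\mathbb{N}},\alpha)$-computable, $C_n\subseteq C_{n+1}$, $\bigcup_nC_n=\Omega$, the multi-function $E\mapsto\{n:E\subseteq C_n\}$ $(\alpha,\nu_{\mathbb{N}})$-computable, and, with $C_0:=\emptyset$, $D_n=C_n\setminus C_{n-1}$ and $\mu(D_n)\ge 2^n$. Notation: $\mathcal{A}_*=\{A\in\mathcal{A}:\mu(A)<\infty\}$, $\mathcal{A}_\infty=\mathcal{A}\setminus\mathcal{A}_*$; $A\bigtriangleup B$ is the symmetric difference; $\langle\cdot\rangle$ is the standard tupling function encoding a sequence of strings as one infinite string. For a sequence $(A_n)$ and $A$ in $\mathcal{A}$, $(A_n)\to_\mu A$ means $\lim_n\mu(A_n\setminus A)=0$ and $\lim_n\mu((A\cap B)\setminus A_n)=0$ for every $B\in\mathcal{A}_*$. The multi-representation $\delta_\mu:\subseteq\Sigma^\omega\rightrightarrows\mathcal{A}$: $A\in\delta_\mu\langle w_1,w_2,\ldots\rangle$ iff, with $A_n:=\alpha(w_n)$, (i) $(A_n)\to_\mu A$; (ii) if $A\in\mathcal{A}_*$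 then $\mu(A_n\bigtriangleup A_m)\le2^{-n}$ for all $n<m$; (iii) if $A\in\mathcal{A}_\infty$ then for all $n<m$: $\mu(A_n\setminus A_m)\le 2^{-n}$, $\mu((A_m\cap C_n)\setminus A_n)\le 2^{-n}$ and $\mu(A_n)\ge 2^n$. Define the probability measure $\widetilde{\mu}(A)=\sum_{n=1}^\infty\frac{\mu(A\cap D_n)}{\mu(D_n)}2^{-n}$ for $A\in\mathcal{A}$. The multi-representation $\delta_{\widetilde{\mu}}:\subseteq\Sigma^\omega\rightrightarrows\mathcal{A}$: $A\in\delta_{\widetilde{\mu}}\langle w_1,w_2,\ldots\rangle$ iff, with $A_n:=\alpha(w_n)$, $\lim_n\widetilde{\mu}(A_n\bigtriangleup A)=0$ and $\widetilde{\mu}(A_n\bigtriangleup A_m)\le 2^{-n}$ for all $n<m$. *)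

theory Defs
  imports "HOL-Analysis.Analysis" "HOL-Library.Stream"
begin

section \<open>Type-2 Turing machines\<close>

text \<open>
  The alphabet is an arbitrary finite type with two distinguished symbols \<open>0 \<noteq> 1\<close>, i.e. a type
  \<open>'a :: {finite, zero_neq_one}\<close>.  The two sorts of strings, \<open>\<Sigma>\<^sup>*\<close> and \<open>\<Sigma>\<^sup>\<omega>\<close>, are
  collected in one type.
\<close>

datatype 'a str = FinStr "'a list" | InfStr "'a stream"

abbreviation fin_strings :: "'a str set" where
  "fin_strings \<equiv> range FinStr"

abbreviation inf_strings :: "'a str set" where
  "inf_strings \<equiv> range InfStr"

text \<open>Content of a cell of an input tape; \<open>None\<close> is the blank behind the end of a finite input.\<close>

primrec symbol_at :: "'a str \<Rightarrow> nat \<Rightarrow> 'a option" where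
  "symbol_at (FinStr w) i = (if i < length w then Some (w ! i) else None)"
| "symbol_at (InfStr s) i = Some (s !! i)"

datatype head_move = Move_Left | Stay | Move_Right

text \<open>
  A machine has states \<open>0, \<dots>, n_states - 1\<close> with initial state \<open>0\<close>, and a work alphabet
  \<open>0, \<dots>, n_symbols - 1\<close> with blank \<open>0\<close>.  From the current state, the symbols under the
  heads of the input tapes and those under the heads of the work tapes, \<open>rule\<close> either
  halts (\<open>None\<close>) or yields the next state, for each input tape whether its (one-way, read-only)
  head advances, for each work tape the symbol written and the head move, and possibly
  one symbol to be appended to the (one-way, write-only) output tape.
\<close>

record 'a machine =
  n_states :: nat
  n_symbols :: nat
  n_inputs :: nat
  n_work :: nat
  rule :: "nat \<Rightarrow> 'a option list \<Rightarrow> nat list \<Rightarrow>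
    (nat \<times> bool list \<times> (nat \<times> head_move) list \<times> 'a option) option"

text \<open>Only the finitely many arguments of \<open>rule\<close> considered here can occur in a run.\<close>

definition wf_machine :: "'a machine \<Rightarrow> bool" where
  "wf_machine T \<longleftrightarrow> 0 < n_states T \<and> 0 < n_symbols T \<and>
     (\<forall>q xs ys q' adv acts out.
        q < n_states T \<longrightarrow> length xs = n_inputs T \<longrightarrow>
        length ys = n_work T \<longrightarrow> (\<forall>y\<in>set ys. y < n_symbols T) \<longrightarrow>
        rule T q xs ys = Some (q', adv, acts, out) \<longrightarrow>
        q' < n_states T \<and> length adv = n_inputs T \<and>
        length acts = n_work T \<and> (\<forall>a\<in>set acts. fst a < n_symbols T))"

record 'a config =
  state :: nat
  in_heads :: "nat list"
  work_tapes :: "((int \<Rightarrow> nat) \<times> int) list"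
  out_tape :: "'a list"

definition init_config :: "'a machine \<Rightarrow> 'a config" where
  "init_config T = \<lparr>state = 0, in_heads = replicate (n_inputs T) 0,
     work_tapes = replicate (n_work T) (\<lambda>_. 0, 0), out_tape = []\<rparr>"

fun work_action :: "(int \<Rightarrow> nat) \<times> int \<Rightarrow> nat \<times> head_move \<Rightarrow> (int \<Rightarrow> nat) \<times> int" where
  "work_action (t, h) (y, d) =
     (t(h := y), case d of Move_Left \<Rightarrow> h - 1 | Stay \<Rightarrow> h | Move_Right \<Rightarrow> h + 1)"

definition step :: "'a machine \<Rightarrow> 'a str list \<Rightarrow> 'a config \<Rightarrow> 'a config option" where
  "step T ps c = map_option
     (\<lambda>(q, adv, acts, out).
        \<lparr>state = q,
         in_heads = map2 (\<lambda>i a. if a then Suc i else i) (in_heads c) adv,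
         work_tapes = map2 work_action (work_tapes c) acts,
         out_tape = out_tape c @ (case out of None \<Rightarrow> [] | Some a \<Rightarrow> [a])\<rparr>)
     (rule T (state c) (map2 symbol_at ps (in_heads c)) (map (\<lambda>(t, h). t h) (work_tapes c)))"

text \<open>Configuration after \<open>n\<close> steps; \<open>None\<close> if the machine has halted before.\<close>

primrec config_after :: "'a machine \<Rightarrow> 'a str list \<Rightarrow> nat \<Rightarrow> 'a config option" where
  "config_after T ps 0 = Some (init_config T)"
| "config_after T ps (Suc n) = Option.bind (config_after T ps n) (step T ps)"

primrec produces :: "'a machine \<Rightarrow> 'a str list \<Rightarrow> 'a str \<Rightarrow> bool" where
  "produces T ps (FinStr w) \<longleftrightarrow>
     (\<exists>n c. config_after T ps n = Some c \<and> step T ps c = None \<and> out_tape c = w)"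
| "produces T ps (InfStr s) \<longleftrightarrow>
     (\<forall>n. \<exists>c. config_after T ps n = Some c \<and> out_tape c = stake (length (out_tape c)) s) \<and>
     (\<forall>k. \<exists>n c. config_after T ps n = Some c \<and> k \<le> length (out_tape c))"

text \<open>
  A machine together with a type specification \<open>(Y\<^sub>1, \<dots>, Y\<^sub>k, Y\<^sub>0)\<close>, each \<open>Y\<^sub>i\<close> being
  \<open>\<Sigma>\<^sup>*\<close> or \<open>\<Sigma>\<^sup>\<omega>\<close>, computes a partial function from \<open>Y\<^sub>1 \<times> \<dots> \<times> Y\<^sub>k\<close> to \<open>Y\<^sub>0\<close>.
\<close>

definition computable_string_fun :: "('a::{finite,zero_neq_one} str list \<rightharpoonup> 'a str) \<Rightarrow> bool" where
  "computable_string_fun F \<longleftrightarrow>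
     (\<exists>T Ys Y0. wf_machine T \<and> n_inputs T = length Ys \<and>
        set Ys \<subseteq> {fin_strings, inf_strings} \<and> Y0 \<in> {fin_strings, inf_strings} \<and>
        (\<forall>ps q. F ps = Some q \<longleftrightarrow> ps \<in> listset Ys \<and> q \<in> Y0 \<and> produces T ps q))"

definition recursive_set :: "'a::{finite,zero_neq_one} list set \<Rightarrow> bool" where
  "recursive_set S \<longleftrightarrow>
     (\<exists>F. computable_string_fun F \<and>
        (\<forall>w. F [FinStr w] = Some (FinStr [if w \<in> S then 1 else 0])))"


section \<open>Naming systems and relative computability\<close>

text \<open>
  A naming system maps every string to the set of the objects it names, with value \<open>{}\<close> outside
  its domain.  Likewise a multi-function \<open>f\<close> has domain \<open>{x. f x \<noteq> {}}\<close>.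
\<close>

type_synonym ('a, 'x) naming = "'a str \<Rightarrow> 'x set"

primrec notation_of :: "('a list \<rightharpoonup> 'x) \<Rightarrow> ('a, 'x) naming" where
  "notation_of \<alpha> (FinStr w) = set_option (\<alpha> w)"
| "notation_of \<alpha> (InfStr s) = {}"

definition computable_wrt ::
  "('a::{finite,zero_neq_one}, 'x) naming \<Rightarrow> ('a, 'y) naming \<Rightarrow> ('x \<Rightarrow> 'y set) \<Rightarrow> bool" where
  "computable_wrt \<delta> \<gamma> f \<longleftrightarrow>
     (\<exists>F. computable_string_fun F \<and>
        (\<forall>x p. f x \<noteq> {} \<longrightarrow> x \<in> \<delta> p \<longrightarrow> (\<exists>q. F [p] = Some q \<and> f x \<inter> \<gamma> q \<noteq> {})))"

definition computable_wrt2 ::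
  "('a::{finite,zero_neq_one}, 'x) naming \<Rightarrow> ('a, 'y) naming \<Rightarrow> ('a, 'z) naming \<Rightarrow>
    ('x \<Rightarrow> 'y \<Rightarrow> 'z set) \<Rightarrow> bool" where
  "computable_wrt2 \<delta> \<delta>' \<gamma> f \<longleftrightarrow>
     (\<exists>F. computable_string_fun F \<and>
        (\<forall>x y p p'. f x y \<noteq> {} \<longrightarrow> x \<in> \<delta> p \<longrightarrow> y \<in> \<delta>' p' \<longrightarrow>
           (\<exists>q. F [p, p'] = Some q \<and> f x y \<inter> \<gamma> q \<noteq> {})))"

definition reducible ::
  "('a::{finite,zero_neq_one}, 'x) naming \<Rightarrow> ('a, 'x) naming \<Rightarrow> bool" (infix "\<preceq>" 50) where
  "\<delta> \<preceq> \<gamma> \<longleftrightarrow> computable_wrt \<delta> \<gamma> (\<lambda>x. {x})"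


section \<open>Tupling and the standard naming systems\<close>

text \<open>
  Weihrauch's wrapping \<open>\<iota>(a\<^sub>1\<dots>a\<^sub>n) = 110a\<^sub>10a\<^sub>20\<dots>a\<^sub>n011\<close> and the infinite tuple
  \<open>\<langle>w\<^sub>1, w\<^sub>2, \<dots>\<rangle> = \<iota>(w\<^sub>1)\<iota>(w\<^sub>2)\<dots>\<close>.  Sequences are indexed from \<open>1\<close>; the value of
  \<open>w\<close> at \<open>0\<close> is irrelevant.
\<close>

definition wrap :: "'a::zero_neq_one list \<Rightarrow> 'a list" where
  "wrap w = [1, 1, 0] @ concat (map (\<lambda>a. [a, 0]) w) @ [1, 1]"

definition tuple :: "(nat \<Rightarrow> 'a::zero_neq_one list) \<Rightarrow> 'a str" where
  "tuple w = InfStr (flat (smap (\<lambda>n. wrap (w n)) (fromN 1)))"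

text \<open>Binary numerals, most significant digit first, without leading zeros.\<close>

definition nu_N :: "'a::zero_neq_one list \<rightharpoonup> nat" where
  "nu_N w =
     (if w = [0] \<or> (w \<noteq> [] \<and> hd w = 1 \<and> set w \<subseteq> {0, 1})
      then Some (horner_sum (\<lambda>a. of_bool (a = 1)) 2 (rev w)) else None)"

text \<open>
  The usual notation of the rationals by fractions of binary numerals.  As the alphabet need not
  contain a sign and a slash, the sign is a leading \<open>0\<close> (plus) or \<open>1\<close> (minus), and numerator and
  denominator are separated by wrapping.
\<close>

definition nu_Q :: "'a::zero_neq_one list \<Rightarrow> rat set" where
  "nu_Q w = {r. \<exists>u v m n. nu_N u = Some m \<and> nu_N v = Some n \<and> n \<noteq> 0 \<and>
     (w = 0 # wrap u @ wrap v \<and> r = of_nat m / of_nat n \<or>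
      w = 1 # wrap u @ wrap v \<and> r = - (of_nat m / of_nat n))}"

text \<open>The standard (Cauchy) representation of the real numbers.\<close>

definition rho :: "('a::zero_neq_one, real) naming" where
  "rho p = {x. \<exists>w r. p = tuple w \<and>
     (\<forall>n\<ge>1. r n \<in> nu_Q (w n) \<and> \<bar>of_rat (r n) - x\<bar> \<le> 1 / 2 ^ n)}"


section \<open>Computable measure spaces\<close>

text \<open>
  The \<open>\<rho>\<close>-computability of \<open>\<mu>\<close> on the ring presupposes that \<open>\<mu>\<close> is real-valued there;
  this is explicit in \<open>ring_finite\<close>, as \<open>measure\<close> is \<open>0\<close> on sets of infinite measure.
\<close>

locale computable_measure_space =
  fixes M :: "'x measure" and R :: "'x set set"
    and \<alpha> :: "'a::{finite,zero_neq_one} list \<rightharpoonup> 'x set"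
  assumes ring: "ring_of_sets (space M) R"
    and countable_ring: "countable R"
    and generates: "sigma_sets (space M) R = sets M"
    and notation_onto: "ran \<alpha> = R"
    and recursive_dom: "recursive_set (dom \<alpha>)"
    and ring_finite: "\<And>A. A \<in> R \<Longrightarrow> emeasure M A < \<infinity>"
    and measure_computable: "computable_wrt (notation_of \<alpha>) rho (\<lambda>A. {measure M A})"
    and union_computable:
      "computable_wrt2 (notation_of \<alpha>) (notation_of \<alpha>) (notation_of \<alpha>) (\<lambda>A B. {A \<union> B})"
    and diff_computable:
      "computable_wrt2 (notation_of \<alpha>) (notation_of \<alpha>) (notation_of \<alpha>) (\<lambda>A B. {A - B})"

definition conv_measure :: "'x measure \<Rightarrow> (nat \<Rightarrow> 'x set) \<Rightarrow> 'x set \<Rightarrow> bool" where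
  "conv_measure M As A \<longleftrightarrow>
     (\<lambda>n. emeasure M (As n - A)) \<longlonglongrightarrow> 0 \<and>
     (\<forall>B\<in>sets M. emeasure M B < \<infinity> \<longrightarrow> (\<lambda>n. emeasure M ((A \<inter> B) - As n)) \<longlonglongrightarrow> 0)"

definition delta_mu ::
  "'x measure \<Rightarrow> ('a::zero_neq_one list \<rightharpoonup> 'x set) \<Rightarrow> (nat \<Rightarrow> 'x set) \<Rightarrow> ('a, 'x set) naming" where
  "delta_mu M \<alpha> C p = {A \<in> sets M. \<exists>w As. p = tuple w \<and> (\<forall>n\<ge>1. \<alpha> (w n) = Some (As n)) \<and>
     conv_measure M As A \<and>
     (emeasure M A < \<infinity> \<longrightarrow>
        (\<forall>n\<ge>1. \<forall>m>n. emeasure M (sym_diff (As n) (As m)) \<le> ennreal (1 / 2 ^ n))) \<and>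
     (emeasure M A = \<infinity> \<longrightarrow>
        (\<forall>n\<ge>1. \<forall>m>n. emeasure M (As n - As m) \<le> ennreal (1 / 2 ^ n) \<and>
           emeasure M ((As m \<inter> C n) - As n) \<le> ennreal (1 / 2 ^ n) \<and>
           emeasure M (As n) \<ge> 2 ^ n))}"

definition mu_tilde :: "'x measure \<Rightarrow> (nat \<Rightarrow> 'x set) \<Rightarrow> 'x set \<Rightarrow> ennreal" where
  "mu_tilde M D A =
     (\<Sum>k. emeasure M (A \<inter> D (Suc k)) / emeasure M (D (Suc k)) * ennreal (1 / 2 ^ Suc k))"

definition delta_mu_tilde ::
  "'x measure \<Rightarrow> ('a::zero_neq_one list \<rightharpoonup> 'x set) \<Rightarrow> (nat \<Rightarrow> 'x set) \<Rightarrow> ('a, 'x set) naming" where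
  "delta_mu_tilde M \<alpha> D p =
     {A \<in> sets M. \<exists>w As. p = tuple w \<and> (\<forall>n\<ge>1. \<alpha> (w n) = Some (As n)) \<and>
        (\<lambda>n. mu_tilde M D (sym_diff (As n) A)) \<longlonglongrightarrow> 0 \<and>
        (\<forall>n\<ge>1. \<forall>m>n. mu_tilde M D (sym_diff (As n) (As m)) \<le> ennreal (1 / 2 ^ n))}"

end

theory Submission
  imports Defs
begin

text \<open>
  The modified measure is at most \<open>\<mu> / 2\<close>, and the complement of \<open>C\<^sub>n\<close> has modified measure at
  most \<open>1 / 2\<^sup>n\<close>.  Hence the sets \<open>A\<^sub>n\<close>, \<open>A\<^sub>m\<close> (\<open>n < m\<close>) of a \<open>\<delta>\<^sub>\<mu>\<close>-name differ by at most
  \<open>2 / 2\<^sup>n\<close> in the modified measure, and dropping the first word yields a name.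

  Conversely, a machine converting names would commit itself to its first output word, naming
  some \<open>E\<close>, after reading a finite part of the constant name of \<open>{}\<close>.  For large \<open>N\<close> that part can
  be continued to a name of \<open>D\<^sub>N\<close>, so that \<open>E\<close> has \<open>\<mu>\<close>-distance at most \<open>1 / 2\<close> from both \<open>{}\<close> and
  \<open>D\<^sub>N\<close>, although \<open>\<mu>(D\<^sub>N) \<ge> 2\<close>.
\<close>

section \<open>Wrapped words and infinite tuples\<close>

text \<open>Wrapping is self-delimiting: after the opening \<open>110\<close> every pair has second
  component 0 until the closing \<open>11\<close>, so the end of the word is recognised whatever
  follows.\<close>

lemma wrap_shift_inject:
  assumes "wrap u @- s = wrap v @- t"
  shows "u = v"
proof -
  have "concat (map (\<lambda>a. [a, 0]) u) @- [1, 1] @- s = concat (map (\<lambda>a. [a, 0]) v) @- [1, 1] @- t"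
    using assms by (simp add: wrap_def)
  then show ?thesis
  proof (induction u arbitrary: v)
    case Nil
    then show ?case by (cases v) auto
  next
    case (Cons a u)
    then show ?case by (cases v) auto
  qed
qed

lemma wrap_not_Nil [simp]: "wrap w \<noteq> []"
  by (simp add: wrap_def)

lemma flat_smap_wrap_fromN:
  "flat (smap (\<lambda>n. wrap (w n)) (fromN m)) = wrap (w m) @- flat (smap (\<lambda>n. wrap (w n)) (fromN (Suc m)))"
  by (subst siterate.code) simp

lemma smap_fromN_Suc: "smap f (fromN (Suc m)) = smap (\<lambda>n. f (Suc n)) (fromN m)"
  by (rule stream.coinduct[where R = "\<lambda>x y. \<exists>m. x = smap f (fromN (Suc m)) \<and> y = smap (\<lambda>n. f (Suc n)) (fromN m)"]) auto

lemma tuple_unfold: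
  "\<exists>s. tuple w = InfStr (wrap (w 1) @- s) \<and> tuple (\<lambda>n. w (Suc n)) = InfStr s"
  unfolding tuple_def by (subst flat_smap_wrap_fromN) (simp add: smap_fromN_Suc)

text \<open>Each wrapped word contributes at least one symbol, so \<open>n\<close> common words
  force at least \<open>n\<close> common symbols. This crude count suffices for the continuity
  argument.\<close>

lemma tuple_eq_stake:
  assumes "\<And>i. 1 \<le> i \<Longrightarrow> i \<le> n \<Longrightarrow> v i = w i"
  shows "\<exists>s t. tuple v = InfStr s \<and> tuple w = InfStr t \<and> stake n s = stake n t"
  using assms
proof (induction n arbitrary: v w)
  case 0
  then show ?case by (simp add: tuple_def)
next
  case (Suc n)
  obtain s t where st: "tuple (\<lambda>n. v (Suc n)) = InfStr s" "tuple (\<lambda>n. w (Suc n)) = InfStr t" "stake n s = stake n t"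
    using Suc.IH[of "\<lambda>n. v (Suc n)" "\<lambda>n. w (Suc n)"] Suc.prems by auto
  have "stake (Suc n) (xs @- s) = stake (Suc n) (xs @- t)" if "xs \<noteq> []" for xs
  proof -
    \<comment> \<open>As \<open>xs\<close> is nonempty, at most \<open>n\<close> symbols remain to
      be compared.\<close>
    have "stake (Suc n - length xs) s = stake (Suc n - length xs) t"
      using st(3) that by (metis Suc_diff_le diff_Suc_Suc diff_le_self length_0_conv min_def not0_implies_Suc take_stake)
    then show ?thesis by (simp only: stake_shift)
  qed
  moreover have "v 1 = w 1" using Suc.prems by simp
  ultimately show ?case
    using tuple_unfold[of v] tuple_unfold[of w] st(1,2) by (metis str.inject(2) wrap_not_Nil)
qed

section \<open>Runs of machines and their outputs\<close>

text \<open>A head advances by at most one cell per step, so the first \<open>m\<close> steps read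
  only cells below \<open>m\<close>. The bound on the heads is part of the claim to carry the
  induction.\<close>

lemma config_after_cong:
  assumes "stake n s = stake n t" "m \<le> n"
  shows "config_after T [InfStr s] m = config_after T [InfStr t] m \<and>
    (\<forall>c. config_after T [InfStr s] m = Some c \<longrightarrow> (\<forall>h\<in>set (in_heads c). h \<le> m))"
  using assms(2)
proof (induction m)
  case 0
  then show ?case by (auto simp: init_config_def)
next
  case (Suc m)
  show ?case
  proof (cases "config_after T [InfStr s] m")
    case None
    then show ?thesis using Suc by simp
  next
    case (Some c)
    with Suc have t: "config_after T [InfStr t] m = Some c"
      and heads: "\<forall>h\<in>set (in_heads c). h \<le> m"
      by simp_all
    have "s !! h = t !! h" if "h \<le> m" for h
      using that Suc.prems assms(1) by (metis Suc_le_lessD le_trans not_less_eq_eq stake_nth linorder_not_le)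
    with heads have "map2 symbol_at [InfStr s] (in_heads c) = map2 symbol_at [InfStr t] (in_heads c)"
      by (cases "in_heads c") auto
    then have "step T [InfStr s] c = step T [InfStr t] c" by (simp only: step_def)
    moreover have "\<forall>h\<in>set (in_heads c'). h \<le> Suc m" if "step T [InfStr s] c = Some c'" for c'
      using that heads by (force simp: step_def dest: set_zip_leftD)
    ultimately show ?thesis by (simp add: Some t)
  qed
qed

lemma config_after_mono:
  assumes "config_after T ps (n + k) = Some c'"
  shows "\<exists>c xs. config_after T ps n = Some c \<and> out_tape c' = out_tape c @ xs"
  using assms
proof (induction k arbitrary: c')
  case (Suc k)
  then obtain c where c: "config_after T ps (n + k) = Some c" "step T ps c = Some c'"
    by (auto simp: bind_eq_Some_conv)
  moreover from c(2) have "\<exists>xs. out_tape c' = out_tape c @ xs"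
    by (auto simp: step_def)
  ultimately show ?case using Suc.IH by fastforce
qed simp

text \<open>Both outputs extend whatever the run has written so far, and the run writes arbitrarily
  long prefixes.\<close>

lemma produces_InfStr_unique:
  assumes "produces T ps (InfStr s)" "produces T ps (InfStr t)"
  shows "s = t"
proof -
  have "stake k s = stake k t" for k
  proof -
    obtain n c where c: "config_after T ps n = Some c" "k \<le> length (out_tape c)"
      using assms(1) by (metis produces.simps(2))
    then have "stake (length (out_tape c)) s = stake (length (out_tape c)) t"
      using assms by (metis option.inject produces.simps(2))
    then show ?thesis using c(2) by (metis min.absorb1 take_stake)
  qed
  then have "s !! n = t !! n" for n
    by (metis lessI stake_nth)
  then show ?thesis
    \<comment> \<open>With \<open>id\<close> as the map, \<open>smap_alt\<close> serves as
      extensionality of streams.\<close>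
    using smap_alt[of id s t] by (simp add: stream.map_id)
qed

text \<open>Restricted to infinite inputs and outputs, \<open>produces\<close> is a functional
  relation by the preceding uniqueness; this justifies \<open>THE\<close> and gives exactly the
  graph that \<open>computable_string_fun\<close> asks for.\<close>

lemma computable_string_fun_produces_inf:
  fixes T :: "'a::{finite,zero_neq_one} machine"
  assumes "wf_machine T" "n_inputs T = 1"
  obtains F where "computable_string_fun F"
    and "\<And>s t. produces T [InfStr s] (InfStr t) \<Longrightarrow> F [InfStr s] = Some (InfStr t)"
proof -
  define P where "P ps q \<longleftrightarrow> ps \<in> listset [inf_strings] \<and> q \<in> inf_strings \<and> produces T ps q" for ps q
  define F where "F ps = (if \<exists>q. P ps q then Some (THE q. P ps q) else None)" for ps
  have "q = q'" if "P ps q" "P ps q'" for ps q q'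
    using that unfolding P_def by (auto dest: produces_InfStr_unique)
  then have F: "F ps = Some q \<longleftrightarrow> P ps q" for ps q
    unfolding F_def by (auto intro: theI the_equality)
  have "computable_string_fun F"
    unfolding computable_string_fun_def
    by (rule exI[of _ T], rule exI[of _ "[inf_strings]"], rule exI[of _ inf_strings])
      (use assms F in \<open>auto simp: P_def\<close>)
  moreover have "F [InfStr s] = Some (InfStr t)" if "produces T [InfStr s] (InfStr t)" for s t
    using that by (simp add: F P_def set_Cons_def)
  ultimately show ?thesis using that by blast
qed

section \<open>A machine dropping the first word of a tuple\<close>

text \<open>
  States 0--2 skip the opening \<open>110\<close>; states 3 and 4 read pairs, where only the closing \<open>11\<close> has a
  second component other than \<open>0\<close>; state 5 copies.
\<close>

definition skip_machine :: "'a::zero_neq_one machine" where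
  "skip_machine = \<lparr>n_states = 6, n_symbols = 1, n_inputs = 1, n_work = 0,
     rule = \<lambda>q xs ys. Some (if q < 4 then q + 1 else if q = 4 \<and> xs = [Some 0] then 3 else 5,
       [True], [], if q < 5 then None else hd xs)\<rparr>"

lemma wf_skip_machine: "wf_machine skip_machine"
  by (auto simp: wf_machine_def skip_machine_def)

text \<open>The input head advances in every step, so its position equals the number of
  steps.\<close>

lemma config_after_skip_Suc:
  assumes "config_after skip_machine [InfStr s] n = Some \<lparr>state = q, in_heads = [n], work_tapes = [], out_tape = xs\<rparr>"
  shows "config_after skip_machine [InfStr s] (Suc n) =
    Some \<lparr>state = (if q < 4 then q + 1 else if q = 4 \<and> s !! n = 0 then 3 else 5), in_heads = [Suc n],
      work_tapes = [], out_tape = (if q < 5 then xs else xs @ [s !! n])\<rparr>"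
  using assms by (auto simp: step_def skip_machine_def)

text \<open>State 3 marks the boundaries between pairs. The part \<open>xs\<close> already read is
  arbitrary, so that each step of the induction on \<open>w\<close> can move one pair into
  it.\<close>

lemma config_after_skip_pairs:
  assumes "S = xs @- concat (map (\<lambda>a. [a, 0]) w) @- [1, 1] @- s"
    and "config_after skip_machine [InfStr S] (length xs) =
      Some \<lparr>state = 3, in_heads = [length xs], work_tapes = [], out_tape = []\<rparr>"
  shows "\<exists>n. sdrop n S = s \<and> config_after skip_machine [InfStr S] n =
    Some \<lparr>state = 5, in_heads = [n], work_tapes = [], out_tape = []\<rparr>"
  using assms
proof (induction w arbitrary: xs)
  case Nil
  have "S !! Suc (length xs) = 1"
    using Nil.prems(1) by (simp add: sdrop_shift flip: sdrop_simps(1))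
  with config_after_skip_Suc[OF config_after_skip_Suc[OF Nil.prems(2)]]
  have "config_after skip_machine [InfStr S] (length xs + 2) =
     Some \<lparr>state = 5, in_heads = [length xs + 2], work_tapes = [], out_tape = []\<rparr>"
    by simp
  moreover have "sdrop (length xs + 2) S = s"
    using Nil.prems(1) by (simp add: sdrop_shift numeral_2_eq_2)
  ultimately show ?case by blast
next
  case (Cons a w)
  have "S !! Suc (length xs) = 0"
    using Cons.prems(1) by (simp add: sdrop_shift flip: sdrop_simps(1))
  with config_after_skip_Suc[OF config_after_skip_Suc[OF Cons.prems(2)]]
  have "config_after skip_machine [InfStr S] (length (xs @ [a, 0])) =
     Some \<lparr>state = 3, in_heads = [length (xs @ [a, 0])], work_tapes = [], out_tape = []\<rparr>"
    by simp
  then show ?case using Cons.IH[of "xs @ [a, 0]"] Cons.prems(1) by simp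
qed

lemma produces_skip_machine:
  "produces skip_machine [InfStr (wrap w @- s)] (InfStr s)"
proof -
  define S where "S = wrap w @- s"
  have "config_after skip_machine [InfStr S] 0 =
    Some \<lparr>state = 0, in_heads = [0], work_tapes = [], out_tape = []\<rparr>"
    by (simp add: init_config_def skip_machine_def)
  from config_after_skip_Suc[OF config_after_skip_Suc[OF config_after_skip_Suc[OF this]]]
  have "config_after skip_machine [InfStr S] (length [1, 1, 0]) =
    Some \<lparr>state = 3, in_heads = [length [1, 1, 0]], work_tapes = [], out_tape = []\<rparr>"
    by (simp add: eval_nat_numeral)
  then obtain n where n: "sdrop n S = s" "config_after skip_machine [InfStr S] n =
      Some \<lparr>state = 5, in_heads = [n], work_tapes = [], out_tape = []\<rparr>"
    using config_after_skip_pairs[of S "[1, 1, 0]" w s] by (auto simp: S_def wrap_def)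
  have run: "config_after skip_machine [InfStr S] (n + k) =
      Some \<lparr>state = 5, in_heads = [n + k], work_tapes = [], out_tape = stake k s\<rparr>" for k
  proof (induction k)
    case (Suc k)
    have "S !! (n + k) = s !! k"
      using n(1) by (metis add.commute sdrop_snth)
    then show ?case
      using config_after_skip_Suc[OF Suc] by (simp add: stake_Suc del: stake.simps config_after.simps)
  qed (use n in simp)
  \<comment> \<open>The output at step \<open>m\<close> is a prefix of that at step
    \<open>n + m\<close>, hence of \<open>s\<close>; this also covers the steps before copying
    starts.\<close>
  have "\<exists>c. config_after skip_machine [InfStr S] m = Some c \<and> out_tape c = stake (length (out_tape c)) s" for m
  proof -
    obtain c xs where "config_after skip_machine [InfStr S] m = Some c" "stake m s = out_tape c @ xs"
      using config_after_mono[of skip_machine "[InfStr S]" m n] run[of m] by (auto simp: add.commute)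
    then show ?thesis
      by (metis append_eq_conv_conj length_append length_stake le_add1 min.absorb1 take_stake)
  qed
  moreover have "\<exists>n c. config_after skip_machine [InfStr S] n = Some c \<and> k \<le> length (out_tape c)" for k
    using run[of k] by (intro exI) auto
  ultimately show ?thesis by (simp add: S_def)
qed

section \<open>Continuity of computable string functions\<close>

text \<open>Some finite number \<open>n\<close> of steps writes \<open>k\<close> output symbols, and
  these steps see at most \<open>n\<close> input symbols.\<close>

lemma computable_string_fun_continuous:
  assumes "computable_string_fun F" "F [InfStr s] = Some (InfStr t)"
  shows "\<exists>n. \<forall>s' t'. stake n s' = stake n s \<longrightarrow> F [InfStr s'] = Some (InfStr t') \<longrightarrow> stake k t' = stake k t"
proof -
  obtain T where T: "\<And>s t. F [InfStr s] = Some (InfStr t) \<Longrightarrow> produces T [InfStr s] (InfStr t)"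
    using assms(1) unfolding computable_string_fun_def by blast
  obtain n c where c: "config_after T [InfStr s] n = Some c" "k \<le> length (out_tape c)"
    using T[OF assms(2)] by (metis produces.simps(2))
  have "stake k t' = stake k t" if "stake n s' = stake n s" "F [InfStr s'] = Some (InfStr t')" for s' t'
  proof -
    have "config_after T [InfStr s'] n = Some c"
      using config_after_cong[OF that(1), of n] c(1) by simp
    then have "stake (length (out_tape c)) t' = stake (length (out_tape c)) t"
      using T[OF that(2)] T[OF assms(2)] c(1) by (metis option.inject produces.simps(2))
    then show ?thesis using c(2) by (metis min.absorb1 take_stake)
  qed
  then show ?thesis by blast
qed

text \<open>The common prefix makes \<open>t\<close> start with \<open>wrap (v 1)\<close> as well as
  with \<open>wrap (w 1)\<close>, and wrapping is self-delimiting.\<close>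

lemma tuple_stake_imp_first_eq:
  assumes "tuple v = InfStr s" "tuple w = InfStr t" "stake (length (wrap (v 1))) s = stake (length (wrap (v 1))) t"
  shows "v 1 = w 1"
proof -
  obtain s' where s: "s = wrap (v 1) @- s'" using tuple_unfold[of v] assms(1) by auto
  obtain t' where t: "t = wrap (w 1) @- t'" using tuple_unfold[of w] assms(2) by auto
  have "t = wrap (v 1) @- sdrop (length (wrap (v 1))) t"
    using assms(3) by (subst stake_sdrop[symmetric, of _ "length (wrap (v 1))"]) (simp add: s stake_shift)
  with t show ?thesis by (metis wrap_shift_inject)
qed

section \<open>Estimates for the modified measure\<close>

text \<open>Index \<open>k\<close> belongs to \<open>D (Suc k)\<close>, so this is the weight of the
  sets \<open>D\<close> beyond \<open>C N\<close>; for \<open>N = 0\<close> it is the total weight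
  1.\<close>

lemma suminf_half_tail: "(\<Sum>k. if k < N then 0 else ennreal (1 / 2 ^ Suc k)) = ennreal (1 / 2 ^ N)"
proof -
  have "(\<lambda>k. if k + N < N then 0 else 1 / 2 ^ Suc (k + N) :: real) sums (1 / 2 ^ N)"
    using sums_mult[OF power_half_series, of "1 / 2 ^ N"]
    by (simp add: power_add power_divide mult_ac)
  then have "(\<lambda>k. if k < N then 0 else 1 / 2 ^ Suc k :: real) sums (1 / 2 ^ N)"
    by (subst (asm) sums_iff_shift) simp
  then have "(\<Sum>k. ennreal (if k < N then 0 else 1 / 2 ^ Suc k)) = ennreal (1 / 2 ^ N)"
    by (intro suminf_ennreal_eq) auto
  then show ?thesis
    by (simp add: if_distrib cong: if_cong)
qed

locale exhaustion =
  fixes M :: "'x measure" and C D :: "nat \<Rightarrow> 'x set"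
  assumes C_sets [measurable]: "\<And>n. C n \<in> sets M"
    and C_finite: "\<And>n. emeasure M (C n) < \<infinity>"
    and C_mono: "mono C"
    and D_eq: "\<And>n. n \<ge> 1 \<Longrightarrow> D n = C n - C (n - 1)"
    and D_large: "\<And>n. n \<ge> 1 \<Longrightarrow> 2 ^ n \<le> emeasure M (D n)"
begin

lemma D_Suc_sets [measurable]: "D (Suc k) \<in> sets M"
  by (simp add: D_eq)

lemma mu_tilde_mono:
  assumes "A \<subseteq> B" and [measurable]: "B \<in> sets M"
  shows "mu_tilde M D A \<le> mu_tilde M D B"
  unfolding mu_tilde_def
proof (intro suminf_le summableI mult_right_mono divide_right_mono_ennreal emeasure_mono)
qed (use assms in auto)

lemma mu_tilde_Un:
  assumes [measurable]: "A \<in> sets M" "B \<in> sets M"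
  shows "mu_tilde M D (A \<union> B) \<le> mu_tilde M D A + mu_tilde M D B"
proof -
  have "emeasure M ((A \<union> B) \<inter> D (Suc k)) / emeasure M (D (Suc k)) * ennreal (1 / 2 ^ Suc k) \<le>
    emeasure M (A \<inter> D (Suc k)) / emeasure M (D (Suc k)) * ennreal (1 / 2 ^ Suc k) +
    emeasure M (B \<inter> D (Suc k)) / emeasure M (D (Suc k)) * ennreal (1 / 2 ^ Suc k)" for k
  proof -
    have "emeasure M ((A \<union> B) \<inter> D (Suc k)) \<le> emeasure M (A \<inter> D (Suc k)) + emeasure M (B \<inter> D (Suc k))"
      by (subst Int_Un_distrib2) (rule emeasure_subadditive; measurable)
    then show ?thesis
      unfolding distrib_right[symmetric] add_divide_distrib_ennreal[symmetric]
      by (intro mult_right_mono divide_right_mono_ennreal) auto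
  qed
  then show ?thesis
    unfolding mu_tilde_def by (subst suminf_add) (auto intro!: suminf_le summableI)
qed

text \<open>Every \<open>D (Suc k)\<close> has measure at least 2, so each quotient is at most half
  the measure of \<open>A\<close>, and the weights add up to 1.\<close>

lemma mu_tilde_le_half:
  assumes [measurable]: "A \<in> sets M"
  shows "mu_tilde M D A \<le> emeasure M A / 2"
proof -
  have "mu_tilde M D A \<le> (\<Sum>k. emeasure M A / 2 * ennreal (1 / 2 ^ Suc k))"
    unfolding mu_tilde_def
  proof (intro suminf_le summableI mult_right_mono)
    fix k
    have "(2::ennreal) \<le> 2 ^ Suc k"
      by (metis one_le_numeral power_increasing power_one_right Suc_le_mono le0 One_nat_def)
    also have "\<dots> \<le> emeasure M (D (Suc k))"
      by (rule D_large) simp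
    finally have D2: "2 \<le> emeasure M (D (Suc k))" .
    have "emeasure M (A \<inter> D (Suc k)) \<le> emeasure M A"
      by (rule emeasure_mono) auto
    also have "\<dots> = emeasure M A / 2 * 2"
      by (simp add: ennreal_divide_times)
    also have "\<dots> \<le> emeasure M A / 2 * emeasure M (D (Suc k))"
      using D2 by (rule mult_left_mono) simp
    finally show "emeasure M (A \<inter> D (Suc k)) / emeasure M (D (Suc k)) \<le> emeasure M A / 2"
      using less_le_trans[OF _ D2, of 0] by (intro divide_le_posI_ennreal) (simp_all add: mult.commute)
  qed auto
  also have "\<dots> = emeasure M A / 2"
    using suminf_half_tail[of 0] by (simp add: ennreal_suminf_cmult)
  finally show ?thesis .
qed

text \<open>The summands with \<open>k < N\<close> vanish because \<open>D (Suc k)\<close> lies in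
  \<open>C N\<close>; each other quotient is at most 1, which leaves a tail of the weights.\<close>

lemma mu_tilde_disjoint_C:
  assumes "A \<inter> C N = {}"
  shows "mu_tilde M D A \<le> ennreal (1 / 2 ^ N)"
proof -
  have "mu_tilde M D A \<le> (\<Sum>k. if k < N then 0 else ennreal (1 / 2 ^ Suc k))"
    unfolding mu_tilde_def
  proof (intro suminf_le summableI)
    fix k
    show "emeasure M (A \<inter> D (Suc k)) / emeasure M (D (Suc k)) * ennreal (1 / 2 ^ Suc k) \<le>
      (if k < N then 0 else ennreal (1 / 2 ^ Suc k))"
    proof (cases "k < N")
      case True
      then have "D (Suc k) \<subseteq> C N"
        using monoD[OF C_mono, of "Suc k" N] by (auto simp: D_eq)
      then have "A \<inter> D (Suc k) = {}"
        using assms by blast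
      then show ?thesis by simp
    next
      case False
      have "emeasure M (D (Suc k)) \<noteq> 0"
        using D_large[of "Suc k"] by auto
      then have "emeasure M (A \<inter> D (Suc k)) / emeasure M (D (Suc k)) \<le> 1"
        by (intro divide_le_posI_ennreal) (auto intro!: emeasure_mono simp: zero_less_iff_neq_zero)
      then have "emeasure M (A \<inter> D (Suc k)) / emeasure M (D (Suc k)) * ennreal (1 / 2 ^ Suc k) \<le> 1 * ennreal (1 / 2 ^ Suc k)"
        by (intro mult_right_mono) auto
      then show ?thesis using False by simp
    qed
  qed
  then show ?thesis by (simp only: suminf_half_tail)
qed

text \<open>The part of \<open>B - A\<close> outside \<open>C n\<close> is charged to the tail of
  the weights. The two remaining differences are those controlled by a \<open>delta_mu\<close>-name
  of a set of infinite measure.\<close>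

lemma mu_tilde_sym_diff_le:
  assumes [measurable]: "A \<in> sets M" "B \<in> sets M"
  shows "mu_tilde M D (sym_diff A B) \<le>
    emeasure M (A - B) / 2 + emeasure M ((B \<inter> C n) - A) / 2 + ennreal (1 / 2 ^ n)"
proof -
  have "mu_tilde M D (sym_diff A B) \<le> mu_tilde M D (((A - B) \<union> ((B \<inter> C n) - A)) \<union> (B - A - C n))"
    by (intro mu_tilde_mono) auto
  also have "\<dots> \<le> mu_tilde M D (A - B) + mu_tilde M D ((B \<inter> C n) - A) + mu_tilde M D (B - A - C n)"
    by (intro order_trans[OF mu_tilde_Un] add_right_mono mu_tilde_Un) measurable
  also have "\<dots> \<le> emeasure M (A - B) / 2 + emeasure M ((B \<inter> C n) - A) / 2 + ennreal (1 / 2 ^ n)"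
    by (intro add_mono mu_tilde_le_half mu_tilde_disjoint_C) (measurable, auto)
  finally show ?thesis .
qed

lemma conv_measure_imp_mu_tilde:
  assumes conv: "conv_measure M As A"
    and [measurable]: "A \<in> sets M" and As: "\<And>n. n \<ge> 1 \<Longrightarrow> As n \<in> sets M"
  shows "(\<lambda>n. mu_tilde M D (sym_diff (As n) A)) \<longlonglongrightarrow> 0"
proof (rule tendsto_zero_ennreal)
  fix r :: real
  assume "0 < r"
  then obtain k where k: "(1 / 2) ^ k < r / 2"
    using real_arch_pow_inv[of "r / 2" "1 / 2"] by auto
  \<comment> \<open>The index \<open>k\<close> is fixed before \<open>n\<close>: since
    \<open>C k\<close> has finite measure, it is an admissible test set in
    \<open>conv_measure\<close>.\<close>
  have "(\<lambda>n. emeasure M (As n - A) / 2 + emeasure M ((A \<inter> C k) - As n) / 2) \<longlonglongrightarrow> 0"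
    unfolding divide_ennreal_def
    by (rule tendsto_eq_intros conv[unfolded conv_measure_def, THEN conjunct1]
        conv[unfolded conv_measure_def, THEN conjunct2, rule_format] C_finite C_sets | simp)+
  then have "\<forall>\<^sub>F n in sequentially. emeasure M (As n - A) / 2 + emeasure M ((A \<inter> C k) - As n) / 2 < ennreal (r / 2)"
    using \<open>0 < r\<close> by (intro order_tendstoD) auto
  then show "\<forall>\<^sub>F n in sequentially. mu_tilde M D (sym_diff (As n) A) < ennreal r"
    using eventually_ge_at_top[of 1]
  proof eventually_elim
    case (elim n)
    have "mu_tilde M D (sym_diff (As n) A) \<le>
      emeasure M (As n - A) / 2 + emeasure M ((A \<inter> C k) - As n) / 2 + ennreal (1 / 2 ^ k)"
      using As elim by (intro mu_tilde_sym_diff_le) auto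
    also have "\<dots> < ennreal (r / 2) + ennreal (r / 2)"
      using elim k \<open>0 < r\<close> by (intro add_strict_mono) (auto simp: power_divide intro!: ennreal_lessI)
    also have "\<dots> = ennreal r"
      using \<open>0 < r\<close> by (simp flip: ennreal_plus)
    finally show ?case .
  qed
qed

section \<open>Names in the two representations\<close>

lemma delta_mu_imp_delta_mu_tilde:
  assumes \<alpha>: "ran \<alpha> \<subseteq> sets M" and A: "A \<in> delta_mu M \<alpha> C p"
  obtains w where "p = tuple w" "A \<in> delta_mu_tilde M \<alpha> D (tuple (\<lambda>n. w (Suc n)))"
proof -
  obtain w As where p: "p = tuple w" and w: "\<forall>n\<ge>1. \<alpha> (w n) = Some (As n)"
    and conv: "conv_measure M As A" and A_sets: "A \<in> sets M"
    and fin: "emeasure M A < \<infinity> \<longrightarrow>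
      (\<forall>n\<ge>1. \<forall>m>n. emeasure M (sym_diff (As n) (As m)) \<le> ennreal (1 / 2 ^ n))"
    and inf: "emeasure M A = \<infinity> \<longrightarrow>
      (\<forall>n\<ge>1. \<forall>m>n. emeasure M (As n - As m) \<le> ennreal (1 / 2 ^ n) \<and>
        emeasure M ((As m \<inter> C n) - As n) \<le> ennreal (1 / 2 ^ n) \<and> emeasure M (As n) \<ge> 2 ^ n)"
    using A unfolding delta_mu_def by blast
  have As: "As n \<in> sets M" if "n \<ge> 1" for n
    using w that \<alpha> by (auto intro: ranI)
  \<comment> \<open>For \<open>A\<close> of finite measure both sets lie in the symmetric
    difference, so the two clauses of \<open>delta_mu\<close> yield the same pair of bounds.\<close>
  have less: "emeasure M (As n - As m) \<le> ennreal (1 / 2 ^ n) \<and>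
      emeasure M ((As m \<inter> C n) - As n) \<le> ennreal (1 / 2 ^ n)" if "n \<ge> 1" "n < m" for n m
  proof (cases "emeasure M A = \<infinity>")
    case False
    then have "emeasure M (sym_diff (As n) (As m)) \<le> ennreal (1 / 2 ^ n)"
      using fin that by (simp add: less_top)
    moreover have "emeasure M X \<le> emeasure M (sym_diff (As n) (As m))" if "X \<subseteq> sym_diff (As n) (As m)" for X
      using As \<open>n \<ge> 1\<close> \<open>n < m\<close> that by (intro emeasure_mono) auto
    ultimately show ?thesis
      by (meson Diff_mono Int_lower1 Un_upper1 Un_upper2 order.refl order_trans)
  qed (use inf that in simp)
  have "mu_tilde M D (sym_diff (As (Suc n)) (As (Suc m))) \<le> ennreal (1 / 2 ^ n)" if "n \<ge> 1" "n < m" for n m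
  proof -
    \<comment> \<open>In units of \<open>1 / 2 ^ n\<close> the three terms are 1/4, 1/4 and 1/2; the
      index shift exactly absorbs the factor 2.\<close>
    have "mu_tilde M D (sym_diff (As (Suc n)) (As (Suc m))) \<le>
      ennreal (1 / 2 ^ Suc n) / 2 + ennreal (1 / 2 ^ Suc n) / 2 + ennreal (1 / 2 ^ Suc n)"
      using less[of "Suc n" "Suc m"] that As
      by (intro order_trans[OF mu_tilde_sym_diff_le[of _ _ "Suc n"]] add_mono divide_right_mono_ennreal) auto
    also have "\<dots> = ennreal (1 / 2 ^ n)"
      by (simp add: ennreal_divide_numeral flip: ennreal_plus)
    finally show ?thesis .
  qed
  moreover have "(\<lambda>n. mu_tilde M D (sym_diff (As (Suc n)) A)) \<longlonglongrightarrow> 0"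
    using conv_measure_imp_mu_tilde[OF conv A_sets As] by (rule LIMSEQ_Suc)
  ultimately have "A \<in> delta_mu_tilde M \<alpha> D (tuple (\<lambda>n. w (Suc n)))"
    using w A_sets unfolding delta_mu_tilde_def
    by (auto intro!: exI[of _ "\<lambda>n. w (Suc n)"] exI[of _ "\<lambda>n. As (Suc n)"])
  with p that show ?thesis by blast
qed

text \<open>Letting \<open>m\<close> tend to infinity in the bound between \<open>As 1\<close> and
  \<open>As m\<close> carries it over to the limit set, so the first word alone is already
  informative.\<close>

lemma delta_mu_first_approx:
  assumes \<alpha>: "ran \<alpha> \<subseteq> sets M" and A: "A \<in> delta_mu M \<alpha> C p" and fin: "emeasure M A < \<infinity>"
  obtains w A1 where "p = tuple w" "\<alpha> (w 1) = Some A1"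
    "emeasure M (A1 - A) \<le> ennreal (1 / 2)" "emeasure M (A - A1) \<le> ennreal (1 / 2)"
proof -
  obtain w As where p: "p = tuple w" and w: "\<And>n. n \<ge> 1 \<Longrightarrow> \<alpha> (w n) = Some (As n)"
    and conv: "conv_measure M As A" and [measurable]: "A \<in> sets M"
    and le: "\<And>m. 1 < m \<Longrightarrow> emeasure M (sym_diff (As 1) (As m)) \<le> ennreal (1 / 2)"
    using A fin unfolding delta_mu_def by fastforce
  have As [measurable]: "As n \<in> sets M" if "n \<ge> 1" for n
    using w[OF that] \<alpha> by (auto intro: ranI)
  \<comment> \<open>For the second limit, \<open>A\<close> itself is the test set of finite
    measure.\<close>
  have lim: "(\<lambda>m. emeasure M (As m - A)) \<longlonglongrightarrow> 0" "(\<lambda>m. emeasure M (A - As m)) \<longlonglongrightarrow> 0"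
    using conv fin \<open>A \<in> sets M\<close> unfolding conv_measure_def by (force, metis Int_absorb)
  have le': "emeasure M X \<le> ennreal (1 / 2) + emeasure M Y"
    if "1 < m" "X \<subseteq> sym_diff (As 1) (As m) \<union> Y" and [measurable]: "Y \<in> sets M" for X Y m
  proof -
    have [measurable]: "As 1 \<in> sets M" "As m \<in> sets M" using that(1) As by auto
    have "emeasure M X \<le> emeasure M (sym_diff (As 1) (As m) \<union> Y)"
      using that(2) by (rule emeasure_mono) measurable
    also have "\<dots> \<le> emeasure M (sym_diff (As 1) (As m)) + emeasure M Y"
      by (rule emeasure_subadditive) measurable
    finally show ?thesis using le[OF that(1)] by (meson add_right_mono order_trans)
  qed
  have "emeasure M (As 1 - A) \<le> ennreal (1 / 2) + 0"
  proof (rule LIMSEQ_le_const[OF tendsto_add[OF tendsto_const lim(1)]], intro exI[of _ 2] allI impI)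
    fix m :: nat
    assume "2 \<le> m"
    then show "emeasure M (As 1 - A) \<le> ennreal (1 / 2) + emeasure M (As m - A)"
      by (intro le'[of m]) auto
  qed
  moreover have "emeasure M (A - As 1) \<le> ennreal (1 / 2) + 0"
  proof (rule LIMSEQ_le_const[OF tendsto_add[OF tendsto_const lim(2)]], intro exI[of _ 2] allI impI)
    fix m :: nat
    assume "2 \<le> m"
    then show "emeasure M (A - As 1) \<le> ennreal (1 / 2) + emeasure M (A - As m)"
      by (intro le'[of m]) auto
  qed
  ultimately show ?thesis using that[OF p w] by simp
qed

text \<open>A set disjoint from \<open>C N\<close> is so small in the modified measure that a name
  may pretend to describe \<open>{}\<close> for \<open>N\<close> words. With \<open>B = {}\<close>
  the lemma also provides the constant name of \<open>{}\<close>.\<close>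

lemma eventually_const_delta_mu_tilde:
  assumes \<alpha>: "\<alpha> e = Some {}" "\<alpha> d = Some B" and B: "B \<in> sets M" "B \<inter> C N = {}"
  shows "B \<in> delta_mu_tilde M \<alpha> D (tuple (\<lambda>n. if n \<le> N then e else d))"
proof -
  let ?As = "\<lambda>n. if n \<le> N then {} else B"
  have "\<forall>\<^sub>F n in sequentially. mu_tilde M D (sym_diff (?As n) B) = 0"
    using eventually_gt_at_top[of N] by eventually_elim (simp add: mu_tilde_def)
  then have "(\<lambda>n. mu_tilde M D (sym_diff (?As n) B)) \<longlonglongrightarrow> 0"
    by (rule tendsto_eventually)
  moreover have "mu_tilde M D (sym_diff (?As n) (?As m)) \<le> ennreal (1 / 2 ^ n)" if "n < m" for n m
  proof (rule mu_tilde_disjoint_C)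
    \<comment> \<open>The difference is nonempty only for \<open>n \<le> N < m\<close>; then it is
      \<open>B\<close>, and \<open>C n\<close> is contained in \<open>C N\<close>.\<close>
    show "sym_diff (?As n) (?As m) \<inter> C n = {}"
      using that B(2) monoD[OF C_mono, of n N] by auto
  qed
  ultimately show ?thesis
    unfolding delta_mu_tilde_def using \<alpha> B(1)
    by (auto intro!: exI[of _ "\<lambda>n. if n \<le> N then e else d"] exI[of _ ?As])
qed

section \<open>The reduction and its failure in the other direction\<close>

lemma delta_mu_reducible:
  fixes \<alpha> :: "'a::{finite,zero_neq_one} list \<rightharpoonup> 'x set"
  assumes "ran \<alpha> \<subseteq> sets M"
  shows "delta_mu M \<alpha> C \<preceq> delta_mu_tilde M \<alpha> D"
proof -
  obtain F :: "'a str list \<rightharpoonup> 'a str" where F: "computable_string_fun F"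
    and F_eq: "\<And>s t. produces skip_machine [InfStr s] (InfStr t) \<Longrightarrow> F [InfStr s] = Some (InfStr t)"
    using computable_string_fun_produces_inf[OF wf_skip_machine]
    by (auto simp: skip_machine_def)
  have "\<exists>q. F [p] = Some q \<and> {A} \<inter> delta_mu_tilde M \<alpha> D q \<noteq> {}" if "A \<in> delta_mu M \<alpha> C p" for A p
  proof -
    obtain w where w: "p = tuple w" "A \<in> delta_mu_tilde M \<alpha> D (tuple (\<lambda>n. w (Suc n)))"
      by (rule delta_mu_imp_delta_mu_tilde[OF assms \<open>A \<in> delta_mu M \<alpha> C p\<close>])
    obtain s where "tuple w = InfStr (wrap (w 1) @- s)" "tuple (\<lambda>n. w (Suc n)) = InfStr s"
      using tuple_unfold by blast
    then show ?thesis
      using w F_eq[OF produces_skip_machine] by auto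
  qed
  with F show ?thesis
    unfolding reducible_def computable_wrt_def by blast
qed

lemma delta_mu_tilde_not_reducible:
  assumes \<alpha>: "ran \<alpha> \<subseteq> sets M" and e: "{} \<in> ran \<alpha>" and D: "\<And>n. D (Suc n) \<in> ran \<alpha>"
  shows "\<not> delta_mu_tilde M \<alpha> D \<preceq> delta_mu M \<alpha> C"
proof
  assume "delta_mu_tilde M \<alpha> D \<preceq> delta_mu M \<alpha> C"
  then obtain F where F: "computable_string_fun F"
    and F_name: "\<And>A p. A \<in> delta_mu_tilde M \<alpha> D p \<Longrightarrow> \<exists>q. F [p] = Some q \<and> A \<in> delta_mu M \<alpha> C q"
    unfolding reducible_def computable_wrt_def by auto
  obtain e where e: "\<alpha> e = Some {}"
    using e by (auto simp: ran_def)
  obtain s where s: "tuple (\<lambda>_. e) = InfStr s"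
    by (simp add: tuple_def)
  obtain q where q: "F [InfStr s] = Some q" "{} \<in> delta_mu M \<alpha> C q"
    using eventually_const_delta_mu_tilde[of \<alpha> e e "{}" 0] e s by (auto dest: F_name)
  obtain v E where v: "q = tuple v" "\<alpha> (v 1) = Some E" "emeasure M (E - {}) \<le> ennreal (1 / 2)"
    using delta_mu_first_approx[OF \<alpha> q(2)] by auto
  obtain t where t: "tuple v = InfStr t"
    by (simp add: tuple_def)
  \<comment> \<open>\<open>N\<close> bounds the input read before the whole wrapped first word of
    the output is fixed.\<close>
  obtain N where N: "\<And>s' t'. stake N s' = stake N s \<Longrightarrow> F [InfStr s'] = Some (InfStr t') \<Longrightarrow>
      stake (length (wrap (v 1))) t' = stake (length (wrap (v 1))) t"
    using computable_string_fun_continuous[OF F, of s t "length (wrap (v 1))"] q(1) v(1) t by auto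
  obtain d where d: "\<alpha> d = Some (D (Suc N))"
    using D[of N] by (auto simp: ran_def)
  \<comment> \<open>\<open>D (Suc N)\<close> is disjoint from \<open>C N\<close>, so it has a name
    starting with \<open>N\<close> copies of \<open>e\<close>; these cover the first
    \<open>N\<close> symbols.\<close>
  obtain s' where s': "tuple (\<lambda>n. if n \<le> N then e else d) = InfStr s'" "stake N s' = stake N s"
    using tuple_eq_stake[of N "\<lambda>n. if n \<le> N then e else d" "\<lambda>_. e"] s by auto
  have "D (Suc N) \<in> delta_mu_tilde M \<alpha> D (InfStr s')"
    using eventually_const_delta_mu_tilde[where N = N, OF e d] s'(1) by (auto simp: D_eq)
  then obtain q' where q': "F [InfStr s'] = Some q'" "D (Suc N) \<in> delta_mu M \<alpha> C q'"
    by (auto dest: F_name)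
  have "emeasure M (D (Suc N)) \<le> emeasure M (C (Suc N))"
    by (intro emeasure_mono) (auto simp: D_eq)
  then have "emeasure M (D (Suc N)) < \<infinity>"
    using C_finite le_less_trans by blast
  then obtain v' E' where v': "q' = tuple v'" "\<alpha> (v' 1) = Some E'"
      "emeasure M (D (Suc N) - E') \<le> ennreal (1 / 2)"
    using delta_mu_first_approx[OF \<alpha> q'(2)] by metis
  obtain t' where t': "tuple v' = InfStr t'"
    by (simp add: tuple_def)
  \<comment> \<open>Both outputs agree on the length of \<open>wrap (v 1)\<close>, which determines
    the first word.\<close>
  have "v 1 = v' 1"
    using tuple_stake_imp_first_eq[OF t t'] N[OF s'(2), of t'] q'(1) v'(1) t' by simp
  with v v' have "E' = E" by simp
  have [measurable]: "E \<in> sets M"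
    using v(2) \<alpha> by (auto intro: ranI)
  have "(2::ennreal) ^ Suc 0 \<le> 2 ^ Suc N"
    by (intro power_increasing) auto
  also have "\<dots> \<le> emeasure M (D (Suc N))"
    by (rule D_large) simp
  also have "\<dots> \<le> emeasure M ((D (Suc N) - E) \<union> E)"
    by (rule emeasure_mono) auto
  also have "\<dots> \<le> emeasure M (D (Suc N) - E) + emeasure M E"
    by (rule emeasure_subadditive) measurable
  also have "\<dots> \<le> ennreal (1 / 2) + ennreal (1 / 2)"
    using v(3) v'(3) \<open>E' = E\<close> by (intro add_mono) auto
  also have "\<dots> = 1"
    by (simp flip: ennreal_plus del: ennreal_half)
  finally show False by simp
qed

end

theorem theorem5p4:
  fixes M :: "'x measure" and R :: "'x set set"
    and \<alpha> :: "'a::{finite,zero_neq_one} list \<rightharpoonup> 'x set"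
    and C D :: "nat \<Rightarrow> 'x set"
  assumes "computable_measure_space M R \<alpha>"
    and "emeasure M (space M) = \<infinity>"
    and "\<forall>n\<ge>1. C n \<in> R" and "\<forall>n\<ge>1. D n \<in> R"
    and "computable_wrt (notation_of nu_N) (notation_of \<alpha>) (\<lambda>n. if n \<ge> 1 then {C n} else {})"
    and "\<forall>n\<ge>1. C n \<subseteq> C (Suc n)"
    and "(\<Union>n\<in>{1..}. C n) = space M"
    and "computable_wrt (notation_of \<alpha>) (notation_of nu_N) (\<lambda>E. {n. n \<ge> 1 \<and> E \<subseteq> C n})"
    and "C 0 = {}"
    and "\<forall>n\<ge>1. D n = C n - C (n - 1)"
    and "\<forall>n\<ge>1. emeasure M (D n) \<ge> 2 ^ n"
  shows "delta_mu M \<alpha> C \<preceq> delta_mu_tilde M \<alpha> D \<and> \<not> delta_mu_tilde M \<alpha> D \<preceq> delta_mu M \<alpha> C"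
proof -
  interpret cms: computable_measure_space M R \<alpha> by fact
  have R_sets: "R \<subseteq> sets M"
    using cms.generates by (metis sigma_sets.Basic subsetI)
  interpret ring_of_sets "space M" R
    by (rule cms.ring)
  \<comment> \<open>At index 0 the set is empty and hence in the ring.\<close>
  have C: "C n \<in> R" for n
    using assms(3) \<open>C 0 = {}\<close> by (cases n) auto
  interpret exhaustion M C D
  proof
    show "mono C"
      using assms(6) \<open>C 0 = {}\<close> by (intro mono_iff_le_Suc[THEN iffD2]) (metis bot.extremum less_one not_less)
  qed (use C R_sets cms.ring_finite assms(10,11) in auto)
  show ?thesis
    using delta_mu_reducible[of \<alpha>] delta_mu_tilde_not_reducible[of \<alpha>] R_sets assms(4)
    by (simp add: cms.notation_onto)
qed

end
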